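(* Let $H\in\mathbb{R}$ and let $\{X(\mu;t):\mu\in\overline\Omega,t\ge0\}$ be a random field such that for every $c>0$ the random fields $$\{c^{-H}X(\mu c^{H-1};ct):\mu\in\overline\Omega,t\ge0\}\quad\text{and}\quad\{X(\mu;t):\mu\in\overline\Omega,t\ge0\}$$ have the same finite-dimensional distributions. Define the Lamperti transform $$Y(\mu;t)=e^{-tH}X(\mu e^{t(H-1)};e^t),\qquad t\in\mathbb{R},\ \mu\in\overline\Omega .$$ Then for each $\mu\in\overline\Omega$ the process $\{Y(\mu;t):t\in\mathbb{R}\}$ is strictly stationary, i.e. for every $s\in\mathbb{R}$ the processes $\{Y(\mu;s+t)\}_{t\in\mathbb{R}}$ and $\{Y(\mu;t)\}_{t\in\mathbb{R}}$ have the same finite-dimensional distributions.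
   Context: $\overline\Omega$ is an interval (possibly containing $\pm\infty$) with $\mathbb{R}_+\subseteq\overline\Omega$ and $c\,\overline\Omega\subseteq\overline\Omega$ for all $c>0$. The random field is real-valued, with all variables defined on a common probability space. *)

theory Defs
  imports "HOL-Probability.Probability"
begin

text \<open>Joint law of a finite subfamily, as a measure on the product space over \<open>J\<close>; it is meaningful
  when the \<open>Z i\<close> with \<open>i \<in> J\<close> are random variables.\<close>

definition joint_law :: "'w measure \<Rightarrow> 'i set \<Rightarrow> ('i \<Rightarrow> 'w \<Rightarrow> real) \<Rightarrow> ('i \<Rightarrow> real) measure" where
  "joint_law M J Z = distr M (PiM J (\<lambda>_. borel)) (\<lambda>\<omega>. \<lambda>i\<in>J. Z i \<omega>)"

definition same_fdd :: "'w measure \<Rightarrow> 'i set \<Rightarrow> ('i \<Rightarrow> 'w \<Rightarrow> real) \<Rightarrow> ('i \<Rightarrow> 'w \<Rightarrow> real) \<Rightarrow> bool" where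
  "same_fdd M I Z W \<longleftrightarrow> (\<forall>J. finite J \<and> J \<subseteq> I \<longrightarrow> joint_law M J Z = joint_law M J W)"

definition strictly_stationary :: "'w measure \<Rightarrow> (real \<Rightarrow> 'w \<Rightarrow> real) \<Rightarrow> bool" where
  "strictly_stationary M Z \<longleftrightarrow>
     (\<forall>t. Z t \<in> borel_measurable M) \<and> (\<forall>s. same_fdd M UNIV (\<lambda>t. Z (s + t)) Z)"

definition lamperti ::
  "real \<Rightarrow> (ereal \<Rightarrow> real \<Rightarrow> 'w \<Rightarrow> real) \<Rightarrow> ereal \<Rightarrow> real \<Rightarrow> 'w \<Rightarrow> real" where
  "lamperti H X \<mu> t \<omega> = exp (- t * H) * X (\<mu> * ereal (exp (t * (H - 1)))) (exp t) \<omega>"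

text \<open>The library's \<^const>\<open>is_interval\<close> is restricted to Euclidean spaces, so intervals of extended
  reals are described by order convexity. The half-line required to lie in the parameter set is the
  open one, so that parameter sets with and without \<open>0\<close> are both covered.\<close>

definition parameter_interval :: "ereal set \<Rightarrow> bool" where
  "parameter_interval \<Omega> \<longleftrightarrow>
     (\<forall>a\<in>\<Omega>. \<forall>b\<in>\<Omega>. {a..b} \<subseteq> \<Omega>) \<and>
     ereal ` {0<..} \<subseteq> \<Omega> \<and>
     (\<forall>c>0. (\<lambda>\<mu>. ereal c * \<mu>) ` \<Omega> \<subseteq> \<Omega>)"

end

theory Submission
  imports Defs
begin

text \<open>With \<open>p t = (\<mu> e\<^bsup>t(H-1)\<^esup>, e\<^sup>t)\<close>, the time shift by \<open>s\<close> of the Lamperti transform at time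
  \<open>t\<close> is \<open>e\<^bsup>-tH\<^esup>\<close> times the field rescaled with \<open>c = e\<^sup>s\<close> at the point \<open>p t\<close>, and the transform
  itself is \<open>e\<^bsup>-tH\<^esup>\<close> times the original field at \<open>p t\<close>. Equality in law survives this common
  reindexing and weighting.\<close>

lemma joint_law_reindex_scale:
  assumes "\<And>i. i \<in> p ` J \<Longrightarrow> Z i \<in> borel_measurable M"
  shows "joint_law M J (\<lambda>t \<omega>. g t * Z (p t) \<omega>) =
    distr (joint_law M (p ` J) Z) (PiM J (\<lambda>_. borel)) (\<lambda>f. \<lambda>t\<in>J. g t * f (p t))"
proof -
  have Z: "(\<lambda>\<omega>. \<lambda>i\<in>p ` J. Z i \<omega>) \<in> measurable M (PiM (p ` J) (\<lambda>_. borel))"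
    using assms by (intro measurable_restrict) auto
  have G: "(\<lambda>f. \<lambda>t\<in>J. g t * f (p t)) \<in>
      measurable (PiM (p ` J) (\<lambda>_. borel)) (PiM J (\<lambda>_. borel :: real measure))"
    by (intro measurable_restrict borel_measurable_times borel_measurable_const
        measurable_component_singleton) auto
  show ?thesis
    unfolding joint_law_def distr_distr[OF G Z]
    by (intro distr_cong) (auto simp: fun_eq_iff)
qed

lemma same_fdd_reindex_scale:
  assumes "same_fdd M I Z W" and "p ` J \<subseteq> I"
    and "\<And>i. i \<in> I \<Longrightarrow> Z i \<in> borel_measurable M"
    and "\<And>i. i \<in> I \<Longrightarrow> W i \<in> borel_measurable M"
  shows "same_fdd M J (\<lambda>t \<omega>. g t * Z (p t) \<omega>) (\<lambda>t \<omega>. g t * W (p t) \<omega>)"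
  unfolding same_fdd_def
proof (intro allI impI)
  fix K assume K: "finite K \<and> K \<subseteq> J"
  with assms(2) have sub: "p ` K \<subseteq> I" by blast
  with K assms(1) have law: "joint_law M (p ` K) Z = joint_law M (p ` K) W"
    unfolding same_fdd_def by blast
  show "joint_law M K (\<lambda>t \<omega>. g t * Z (p t) \<omega>) = joint_law M K (\<lambda>t \<omega>. g t * W (p t) \<omega>)"
    using sub assms(3,4) law by (subst (1 2) joint_law_reindex_scale) auto
qed

lemma parameter_interval_scale:
  assumes "parameter_interval \<Omega>" and "\<mu> \<in> \<Omega>" and "0 < c"
  shows "\<mu> * ereal c \<in> \<Omega>"
  using assms unfolding parameter_interval_def image_subset_iff by (metis mult.commute)

text \<open>Splits the exponentials of \<open>s + t\<close>; the factors in \<open>s\<close> are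
  written as powers of \<open>exp s\<close> to match the scaling hypothesis at
  \<open>c = exp s\<close>.\<close>

lemma lamperti_shift:
  "lamperti H X \<mu> (s + t) \<omega> = exp (- t * H) * (exp s powr (- H) *
     X (\<mu> * ereal (exp (t * (H - 1))) * ereal (exp s powr (H - 1))) (exp s * exp t) \<omega>)"
proof -
  \<comment> \<open>Multiplication of extended reals is associative, so only the finite factors are
    merged and \<open>\<mu>\<close> may be infinite.\<close>
  have "\<mu> * ereal (exp ((s + t) * (H - 1))) =
      \<mu> * ereal (exp (t * (H - 1))) * ereal (exp s powr (H - 1))"
    by (simp add: powr_def mult.assoc algebra_simps flip: exp_add)
  moreover have "exp (- (s + t) * H) = exp (- t * H) * exp s powr (- H)"
    by (simp add: powr_def algebra_simps flip: exp_add)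
  ultimately show ?thesis
    by (simp only: lamperti_def exp_add mult.assoc)
qed

theorem mainTheorem5:
  fixes M :: "'w measure" and H :: real and \<Omega> :: "ereal set"
    and X :: "ereal \<Rightarrow> real \<Rightarrow> 'w \<Rightarrow> real"
  assumes "prob_space M"
    and "parameter_interval \<Omega>"
    and "\<And>\<mu> t. \<mu> \<in> \<Omega> \<Longrightarrow> t \<ge> 0 \<Longrightarrow> X \<mu> t \<in> borel_measurable M"
    and "\<And>c. c > 0 \<Longrightarrow>
           same_fdd M (\<Omega> \<times> {0..})
             (\<lambda>(\<mu>, t) \<omega>. c powr (- H) * X (\<mu> * ereal (c powr (H - 1))) (c * t) \<omega>)
             (\<lambda>(\<mu>, t). X \<mu> t)"
  shows "\<forall>\<mu>\<in>\<Omega>. strictly_stationary M (lamperti H X \<mu>)"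
proof
  fix \<mu> assume \<mu>: "\<mu> \<in> \<Omega>"
  note scale = parameter_interval_scale[OF assms(2)]
  have "lamperti H X \<mu> t \<in> borel_measurable M" for t
    unfolding lamperti_def[abs_def]
    by (intro borel_measurable_times borel_measurable_const assms(3) scale \<mu>) auto
  moreover have "same_fdd M UNIV (\<lambda>t. lamperti H X \<mu> (s + t)) (lamperti H X \<mu>)" for s
  proof -
    let ?p = "\<lambda>t. (\<mu> * ereal (exp (t * (H - 1))), exp t)"
    let ?W = "\<lambda>(\<mu>, t). X \<mu> t"
    let ?Z = "\<lambda>(\<mu>, t) \<omega>. exp s powr (- H) * X (\<mu> * ereal (exp s powr (H - 1))) (exp s * t) \<omega>"
    have "same_fdd M UNIV (\<lambda>t \<omega>. exp (- t * H) * ?Z (?p t) \<omega>)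
        (\<lambda>t \<omega>. exp (- t * H) * ?W (?p t) \<omega>)"
    proof (rule same_fdd_reindex_scale)
      show "same_fdd M (\<Omega> \<times> {0..}) ?Z ?W"
        by (rule assms(4)) simp
      \<comment> \<open>Positivity of \<open>exp\<close> keeps the first coordinate in
        \<open>\<Omega>\<close> and the second in the half-line.\<close>
      show "range ?p \<subseteq> \<Omega> \<times> {0..}"
        using scale[OF \<mu>] by auto
      show "?Z i \<in> borel_measurable M" if "i \<in> \<Omega> \<times> {0..}" for i
        using that by (auto intro!: borel_measurable_times assms(3) scale)
      show "?W i \<in> borel_measurable M" if "i \<in> \<Omega> \<times> {0..}" for i
        using that assms(3) by auto
    qed
    moreover have "(\<lambda>t \<omega>. exp (- t * H) * ?Z (?p t) \<omega>) = (\<lambda>t. lamperti H X \<mu> (s + t))"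
      by (simp only: fun_eq_iff lamperti_shift prod.case) simp
    moreover have "(\<lambda>t \<omega>. exp (- t * H) * ?W (?p t) \<omega>) = lamperti H X \<mu>"
      by (simp add: fun_eq_iff lamperti_def)
    ultimately show ?thesis by simp
  qed
  ultimately show "strictly_stationary M (lamperti H X \<mu>)"
    unfolding strictly_stationary_def by blast
qed

end
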